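(* Let $G=(V,E)$ be a finite digraph without loops that has a vertex $a$ with $n\ge 1$ outcoming edges $a\to b_0,\ a\to b_1,\dots,a\to b_{n-1}$ (these being all the outcoming edges of $a$) and no incoming edges. Assume also that $b_0\to b_i$ for all $i\ge1$. Let $G'=(V',E')$ be the digraph obtained from $G$ by removing the vertex $a$ with all adjacent edges, that is, $V'=V\setminus\{a\}$ and $E'=E\setminus\{ab_i\}_{i=0}^{n-1}$. Then, for any $p\ge0$, $$\dim H_p(G)=\dim H_p(G').$$
   Context: Fix a field $\mathbb K$. A finite digraph $G=(V,E)$ consists of a finite vertex set $V$ and $E\subset V\times V$; write $i\to j$ (edge $ij$) if $(i,j)\in E$. No loops: never $i\to i$. For $p\ge 0$, an elementary $p$-path is a sequence $i_0\dots i_p$ of vertices; it is regular if $i_{k-1}\ne i_k$ for all $k$. $\mathcal R_p$ is the $\mathbb K$-vector space with basis $\{e_{i_0\dots i_p}: i_0\dots i_p\text{ regular}\}$. The regular boundary operator $\partial:\mathcal R_p\to\mathcal R_{p-1}$, $p\ge1$, is $\partial e_{i_0\dots i_p}=\sum_{q=0}^p(-1)^qe_{i_0\dots\widehat{i_q}\dots i_p}$, with every term indexed by a non-regular sequence replaced by $0$; $\partial=0$ on $\mathcal R_0$. An elementary path $i_0\dots i_p$ is allowed if $i_{k-1}\to i_k$ for all $k=1,\dots,p$. $\mathcal A_p=\mathcal A_p(G)$ is the span of $e_{i_0\dots i_p}$ over allowed $p$-paths, $\mathcal A_{-1}=\{0\}$, and $\Omega_p=\Omega_p(G)=\{v\in\mathcal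 A_p:\partial v\in\mathcal A_{p-1}\}$. The path homologies $H_p(G)$, $p\ge0$, are the homologies of the chain complex $0\leftarrow\Omega_0\leftarrow\Omega_1\leftarrow\Omega_2\leftarrow\cdots$ with differential $\partial$. *)

theory Defs
  imports
    "HOL-Library.Poly_Mapping"
    "Graph_Theory.Pair_Digraph"
    "Jordan_Normal_Form.VS_Connect"
begin

section \<open>Chains of elementary paths\<close>

text \<open>
  The elementary \<open>p\<close>-path \<open>i\<^sub>0\<dots>i\<^sub>p\<close> is the list \<open>[i\<^sub>0, \<dots>, i\<^sub>p]\<close> of length \<open>p + 1\<close>; it is regular
  iff \<^const>\<open>distinct_adj\<close> holds of it. A chain is a finitely supported function from lists to the
  field, and \<open>e\<^bsub>s\<^esub>\<close> is \<open>Poly_Mapping.single s 1\<close>.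
\<close>

type_synonym ('v, 'k) chain = "'v list \<Rightarrow>\<^sub>0 'k"

definition chain_scale :: "'k \<Rightarrow> ('v, 'k::field) chain \<Rightarrow> ('v, 'k) chain" where
  "chain_scale c v = Poly_Mapping.map ((*) c) v"

definition omit_nth :: "nat \<Rightarrow> 'v list \<Rightarrow> 'v list" where
  "omit_nth q s = take q s @ drop (Suc q) s"

text \<open>
  The first case makes the boundary vanish on \<open>0\<close>-paths: without it, \<open>e\<^bsub>[x]\<^esub>\<close> would be sent to
  \<open>e\<^bsub>[]\<^esub>\<close>, which would give the augmented complex.
\<close>

definition path_boundary :: "'v list \<Rightarrow> ('v, 'k::field) chain" where
  "path_boundary s =
     (if length s \<le> 1 then 0
      else \<Sum>q<length s. if distinct_adj (omit_nth q s)
                       then Poly_Mapping.single (omit_nth q s) ((-1) ^ q) else 0)"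

definition boundary :: "('v, 'k::field) chain \<Rightarrow> ('v, 'k) chain" where
  "boundary v =
     (\<Sum>s\<in>Poly_Mapping.keys v. chain_scale (Poly_Mapping.lookup v s) (path_boundary s))"


section \<open>The path complex of a digraph\<close>

definition allowed_paths :: "'v pair_pre_digraph \<Rightarrow> nat \<Rightarrow> 'v list set" where
  "allowed_paths G p =
     {s. length s = p + 1 \<and> set s \<subseteq> pverts G \<and> successively (\<lambda>x y. (x, y) \<in> parcs G) s}"

text \<open>The span of the \<open>e\<^bsub>s\<^esub>\<close> with \<open>s\<close> allowed, i.e. the chains supported on allowed paths.\<close>

definition allowed_chains :: "'v pair_pre_digraph \<Rightarrow> nat \<Rightarrow> ('v, 'k::field) chain set" where
  "allowed_chains G p = {v. Poly_Mapping.keys v \<subseteq> allowed_paths G p}"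

text \<open>The case \<open>p = 0\<close> encodes \<open>\<A>\<^bsub>-1\<^esub> = {0}\<close>.\<close>

definition Omega :: "'v pair_pre_digraph \<Rightarrow> nat \<Rightarrow> ('v, 'k::field) chain set" where
  "Omega G p =
     {v \<in> allowed_chains G p.
        boundary v \<in> (case p of 0 \<Rightarrow> {0} | Suc q \<Rightarrow> allowed_chains G q)}"

definition cycles :: "'v pair_pre_digraph \<Rightarrow> nat \<Rightarrow> ('v, 'k::field) chain set" where
  "cycles G p = {v \<in> Omega G p. boundary v = 0}"

definition boundaries :: "'v pair_pre_digraph \<Rightarrow> nat \<Rightarrow> ('v, 'k::field) chain set" where
  "boundaries G p = boundary ` Omega G (Suc p)"


section \<open>Path homology as a quotient vector space\<close>

text \<open>
  The quotient of \<open>Z\<close> by \<open>B\<close>, whose elements are the cosets \<open>z + B\<close>. Adding \<open>B\<close> in the scalar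
  multiplication matters only for the scalar \<open>0\<close>. The fields \<open>mult\<close> and \<open>one\<close> of the record are
  not used by modules.
\<close>

definition chain_quotient ::
  "('v, 'k::field) chain set \<Rightarrow> ('v, 'k) chain set \<Rightarrow> ('k, ('v, 'k) chain set) module" where
  "chain_quotient Z B =
     \<lparr> carrier = (\<lambda>z. {z + b |b. b \<in> B}) ` Z,
       mult = undefined, one = undefined,
       zero = B,
       add = (\<lambda>X Y. {x + y |x y. x \<in> X \<and> y \<in> Y}),
       smult = (\<lambda>c X. {chain_scale c x + b |x b. x \<in> X \<and> b \<in> B}) \<rparr>"

definition path_homology ::
  "'v pair_pre_digraph \<Rightarrow> nat \<Rightarrow> ('k::field, ('v, 'k) chain set) module" where
  "path_homology G p = chain_quotient (cycles G p) (boundaries G p)"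


subsection \<open>Path homology is a vector space\<close>

lemma lookup_chain_scale [simp]:
  "Poly_Mapping.lookup (chain_scale c v) s = c * Poly_Mapping.lookup v s"
  by (simp add: chain_scale_def Poly_Mapping.map.rep_eq when_def)

lemma chain_scale_simps:
  "chain_scale c (u + v) = chain_scale c u + chain_scale c v"
  "chain_scale (c + d) v = chain_scale c v + chain_scale d v"
  "chain_scale c (chain_scale d v) = chain_scale (c * d) v"
  "chain_scale 1 v = v" "chain_scale 0 v = 0" "chain_scale c 0 = 0"
  by (auto intro!: poly_mapping_eqI simp: lookup_add algebra_simps)

lemma chain_scale_sum: "chain_scale c (sum f A) = (\<Sum>x\<in>A. chain_scale c (f x))"
  by (induction A rule: infinite_finite_induct) (auto simp: chain_scale_simps)

lemma boundary_superset:
  assumes "finite S" "Poly_Mapping.keys v \<subseteq> S"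
  shows "boundary v = (\<Sum>s\<in>S. chain_scale (Poly_Mapping.lookup v s) (path_boundary s))"
  unfolding boundary_def using assms
  by (intro sum.mono_neutral_left) (auto simp: in_keys_iff chain_scale_simps)

lemma boundary_add: "boundary (u + v) = boundary u + boundary v"
proof -
  let ?S = "Poly_Mapping.keys u \<union> Poly_Mapping.keys v"
  have "Poly_Mapping.keys (u + v) \<subseteq> ?S" by (rule Poly_Mapping.keys_add)
  then show ?thesis
    using boundary_superset[of ?S u] boundary_superset[of ?S v] boundary_superset[of ?S "u + v"]
    by (simp add: lookup_add chain_scale_simps sum.distrib)
qed

lemma keys_chain_scale: "Poly_Mapping.keys (chain_scale c v) \<subseteq> Poly_Mapping.keys v"
  by (auto simp: in_keys_iff)

lemma boundary_scale: "boundary (chain_scale c v) = chain_scale c (boundary v)"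
  using boundary_superset[of "Poly_Mapping.keys v" "chain_scale c v"] keys_chain_scale[of c v]
  by (simp add: boundary_def chain_scale_simps chain_scale_sum)

lemma boundary_zero [simp]: "boundary 0 = 0"
  by (simp add: boundary_def)

definition chain_subspace :: "('v, 'k::field) chain set \<Rightarrow> bool" where
  "chain_subspace W \<longleftrightarrow>
     0 \<in> W \<and> (\<forall>u\<in>W. \<forall>v\<in>W. u + v \<in> W) \<and> (\<forall>c. \<forall>v\<in>W. chain_scale c v \<in> W)"

lemma chain_subspaceD:
  assumes "chain_subspace W"
  shows "0 \<in> W" "u \<in> W \<Longrightarrow> v \<in> W \<Longrightarrow> u + v \<in> W" "v \<in> W \<Longrightarrow> chain_scale c v \<in> W"
    "v \<in> W \<Longrightarrow> - v \<in> W" "u \<in> W \<Longrightarrow> v \<in> W \<Longrightarrow> u - v \<in> W"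
proof -
  show *: "0 \<in> W" "u \<in> W \<Longrightarrow> v \<in> W \<Longrightarrow> u + v \<in> W" "v \<in> W \<Longrightarrow> chain_scale c v \<in> W" for u v c
    using assms by (auto simp: chain_subspace_def)
  have eq: "chain_scale (-1) v = - v" for v :: "('a, 'b) chain"
    by (rule poly_mapping_eqI) simp
  show **: "v \<in> W \<Longrightarrow> - v \<in> W" for v using *(3)[of v "-1"] by (simp add: eq)
  show "u \<in> W \<Longrightarrow> v \<in> W \<Longrightarrow> u - v \<in> W" using *(2)[of u "-v"] ** by simp
qed

lemma chain_subspace_allowed_chains: "chain_subspace (allowed_chains G p)"
proof -
  have "Poly_Mapping.keys (u + v) \<subseteq> S"
    if "Poly_Mapping.keys u \<subseteq> S" "Poly_Mapping.keys v \<subseteq> S" for u v :: "('a, 'b) chain" and S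
    using Poly_Mapping.keys_add[of u v] that by blast
  moreover have "Poly_Mapping.keys (chain_scale c v) \<subseteq> S"
    if "Poly_Mapping.keys v \<subseteq> S" for c and v :: "('a, 'b) chain" and S
    using keys_chain_scale[of c v] that by blast
  ultimately show ?thesis
    unfolding chain_subspace_def allowed_chains_def by simp
qed

lemma chain_subspace_Omega: "chain_subspace (Omega G p)"
  using chain_subspace_allowed_chains[of G p] chain_subspace_allowed_chains[of G "p - 1"]
  unfolding Omega_def chain_subspace_def
  by (cases p) (auto simp: boundary_add boundary_scale chain_scale_simps)

lemma chain_subspace_cycles: "chain_subspace (cycles G p)"
  using chain_subspace_Omega[of G p] unfolding cycles_def chain_subspace_def
  by (auto simp: boundary_add boundary_scale chain_scale_simps)

lemma chain_subspace_boundaries: "chain_subspace (boundaries G p)"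
  unfolding chain_subspace_def boundaries_def
proof (intro conjI ballI allI)
  note W = chain_subspaceD[OF chain_subspace_Omega[of G "Suc p"]]
  show "0 \<in> boundary ` Omega G (Suc p)"
    using W(1) by (rule image_eqI[rotated]) simp
  fix u v :: "('a, 'b) chain"
  assume "u \<in> boundary ` Omega G (Suc p)"
  then obtain x where x: "u = boundary x" "x \<in> Omega G (Suc p)" by (rule imageE)
  show "chain_scale c u \<in> boundary ` Omega G (Suc p)" for c
    unfolding x(1) boundary_scale[symmetric] by (intro imageI W(3) x(2))
  assume "v \<in> boundary ` Omega G (Suc p)"
  then obtain y where y: "v = boundary y" "y \<in> Omega G (Suc p)" by (rule imageE)
  show "u + v \<in> boundary ` Omega G (Suc p)"
    unfolding x(1) y(1) boundary_add[symmetric] by (intro imageI W(2) x(2) y(2))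
qed

lemma vectorspace_chain_quotient:
  fixes Z B :: "('v, 'k::field) chain set"
  assumes Z: "chain_subspace Z" and B: "chain_subspace B"
  shows "vectorspace (class_ring :: 'k ring) (chain_quotient Z B)"
proof -
  let ?Q = "chain_quotient Z B"
  define cs where "cs z = {z + b |b. b \<in> B}" for z
  note ZD = chain_subspaceD[OF Z] and BD = chain_subspaceD[OF B]
  have in_cs: "x \<in> cs z \<longleftrightarrow> x - z \<in> B" for x z
    unfolding cs_def by (auto intro: exI[of _ "x - z"])
  have carr: "carrier ?Q = cs ` Z"
    by (auto simp: chain_quotient_def cs_def[abs_def])
  have zero: "\<zero>\<^bsub>?Q\<^esub> = cs 0"
    by (auto simp: chain_quotient_def cs_def)
  have add: "cs x \<oplus>\<^bsub>?Q\<^esub> cs y = cs (x + y)" for x y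
  proof (intro equalityI subsetI)
    fix t assume "t \<in> cs x \<oplus>\<^bsub>?Q\<^esub> cs y"
    then obtain u v where uv: "t = u + v" "u - x \<in> B" "v - y \<in> B"
      by (auto simp: chain_quotient_def in_cs)
    with BD(2)[of "u - x" "v - y"] show "t \<in> cs (x + y)"
      by (simp add: in_cs algebra_simps)
  next
    fix t assume "t \<in> cs (x + y)"
    then have "t - y \<in> cs x" by (simp add: in_cs algebra_simps)
    moreover have "y \<in> cs y" by (simp add: in_cs BD)
    ultimately have "\<exists>u v. t = u + v \<and> u \<in> cs x \<and> v \<in> cs y"
      by (metis diff_add_cancel)
    then show "t \<in> cs x \<oplus>\<^bsub>?Q\<^esub> cs y" by (simp add: chain_quotient_def)
  qed
  have smult: "c \<odot>\<^bsub>?Q\<^esub> cs x = cs (chain_scale c x)" for c x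
  proof (intro equalityI subsetI)
    fix t assume "t \<in> c \<odot>\<^bsub>?Q\<^esub> cs x"
    then obtain u b where ub: "t = chain_scale c (x + u) + b" "u \<in> B" "b \<in> B"
      by (auto simp: chain_quotient_def cs_def)
    with BD(2,3) show "t \<in> cs (chain_scale c x)"
      by (simp add: in_cs chain_scale_simps algebra_simps)
  next
    fix t assume "t \<in> cs (chain_scale c x)"
    then obtain b where "t = chain_scale c x + b" "b \<in> B" by (auto simp: cs_def)
    moreover have "x \<in> cs x" by (simp add: in_cs BD)
    ultimately show "t \<in> c \<odot>\<^bsub>?Q\<^esub> cs x" by (auto simp: chain_quotient_def)
  qed
  have "abelian_group ?Q"
  proof (rule abelian_groupI)
    fix x assume "x \<in> carrier ?Q"
    then obtain z where "x = cs z" "z \<in> Z" by (auto simp: carr)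
    then have "cs (- z) \<in> carrier ?Q" "cs (- z) \<oplus>\<^bsub>?Q\<^esub> x = \<zero>\<^bsub>?Q\<^esub>"
      by (auto simp: carr add zero ZD)
    then show "\<exists>y\<in>carrier ?Q. y \<oplus>\<^bsub>?Q\<^esub> x = \<zero>\<^bsub>?Q\<^esub>" by blast
  qed (auto simp: carr add zero ZD algebra_simps)
  then interpret abelian_group ?Q .
  show ?thesis
    by unfold_locales (auto simp: carr add smult ZD chain_scale_simps)
qed

lemma vectorspace_path_homology:
  "vectorspace (class_ring :: 'k::field ring)
     (path_homology G p :: ('k, ('v, 'k) chain set) module)"
  unfolding path_homology_def
  by (intro vectorspace_chain_quotient chain_subspace_cycles chain_subspace_boundaries)

end

theory Submission
  imports Defs
begin

text \<open>
  The digraph \<open>G'\<close> is a deformation retract of \<open>G\<close>. Let \<open>f\<close> send \<open>a\<close> to \<open>b\<^sub>0\<close> and fix every other vertex.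
  Because every out-neighbour of \<open>a\<close> is \<open>b\<^sub>0\<close> or an out-neighbour of \<open>b\<^sub>0\<close>, the map \<open>f\<close> sends each edge
  of \<open>G\<close> to an edge of \<open>G'\<close> or collapses it. So it induces a chain map \<open>F\<close> from \<open>\<Omega>(G)\<close> to \<open>\<Omega>(G')\<close>
  (\<open>boundary_path_map\<close>, \<open>path_map_Omega\<close>) which is the identity on \<open>\<Omega>(G')\<close>.

  As \<open>a\<close> has no incoming edge, it can occur in an allowed path only as the first vertex. Put
  \<open>H(a t) = a b\<^sub>0 t\<close>, read as \<open>0\<close> if \<open>t\<close> begins with \<open>b\<^sub>0\<close>, and \<open>H = 0\<close> on paths that do not begin with
  \<open>a\<close>. Then \<open>\<partial>H + H\<partial> = F - id\<close> (\<open>prism_homotopy\<close>), and \<open>H\<close> preserves allowed chains because of the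
  edges from \<open>a\<close> to \<open>b\<^sub>0\<close> and from \<open>b\<^sub>0\<close> to \<open>b\<^sub>i\<close>.

  Hence the inclusion of \<open>G'\<close> in \<open>G\<close> is an isomorphism on homology: a cycle \<open>z\<close> of \<open>G\<close> differs from the
  cycle \<open>F z\<close> of \<open>G'\<close> by the boundary of \<open>H z\<close>, and if a cycle \<open>z\<close> of \<open>G'\<close> is \<open>\<partial>w\<close> with \<open>w\<close> in \<open>\<Omega>(G)\<close>,
  then \<open>z = F z = \<partial>(F w)\<close>. The lemma \<open>dim_chain_quotient_inclusion\<close> turns this into the equality of
  dimensions.

  To avoid case distinctions on which faces of a path are regular, both chain-level identities are
  first proved for the simplicial boundary on all lists, where the recursion on the first vertex
  makes them formal, and are then pushed through the projection that kills the non-regular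
  lists and the empty list.
\<close>

section \<open>Linear maps given on basis paths\<close>

definition lin_ext :: "('v list \<Rightarrow> ('w, 'k::field) chain) \<Rightarrow> ('v, 'k) chain \<Rightarrow> ('w, 'k) chain" where
  "lin_ext g v = (\<Sum>s\<in>Poly_Mapping.keys v. chain_scale (Poly_Mapping.lookup v s) (g s))"

lemma boundary_eq_lin_ext: "boundary = lin_ext path_boundary"
  by (simp add: fun_eq_iff boundary_def lin_ext_def)

lemma lin_ext_superset:
  assumes "finite S" "Poly_Mapping.keys v \<subseteq> S"
  shows "lin_ext g v = (\<Sum>s\<in>S. chain_scale (Poly_Mapping.lookup v s) (g s))"
  unfolding lin_ext_def using assms
  by (intro sum.mono_neutral_left) (auto simp: in_keys_iff chain_scale_simps)

lemma lin_ext_add: "lin_ext g (u + v) = lin_ext g u + lin_ext g v"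
proof -
  let ?S = "Poly_Mapping.keys u \<union> Poly_Mapping.keys v"
  have "Poly_Mapping.keys (u + v) \<subseteq> ?S" by (rule Poly_Mapping.keys_add)
  then show ?thesis
    using lin_ext_superset[of ?S u g] lin_ext_superset[of ?S v g] lin_ext_superset[of ?S "u + v" g]
    by (simp add: lookup_add chain_scale_simps sum.distrib)
qed

lemma lin_ext_zero [simp]: "lin_ext g 0 = 0"
  by (simp add: lin_ext_def)

lemma lin_ext_diff: "lin_ext g (u - v) = lin_ext g u - lin_ext g v"
  using lin_ext_add[of g "u - v" v] by (simp add: algebra_simps)

lemma lin_ext_scale: "lin_ext g (chain_scale c v) = chain_scale c (lin_ext g v)"
  using lin_ext_superset[of "Poly_Mapping.keys v" "chain_scale c v" g] keys_chain_scale[of c v]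
  by (simp add: lin_ext_def chain_scale_simps chain_scale_sum)

lemma lin_ext_sum: "lin_ext g (sum f A) = (\<Sum>x\<in>A. lin_ext g (f x))"
  by (induction A rule: infinite_finite_induct) (auto simp: lin_ext_add)

lemma lin_ext_single [simp]: "lin_ext g (Poly_Mapping.single s c) = chain_scale c (g s)"
  by (cases "c = 0") (simp_all add: lin_ext_def chain_scale_simps)

lemma lin_ext_comp: "lin_ext g (lin_ext f v) = lin_ext (\<lambda>s. lin_ext g (f s)) v"
  by (simp add: lin_ext_def[of f] lin_ext_def[of "\<lambda>s. lin_ext g (f s)"] lin_ext_sum lin_ext_scale)

lemma lin_ext_cong:
  "(\<And>s. s \<in> Poly_Mapping.keys v \<Longrightarrow> f s = g s) \<Longrightarrow> lin_ext f v = lin_ext g v"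
  by (simp add: lin_ext_def)

lemma lin_ext_plus_fun: "lin_ext (\<lambda>s. f s + g s) v = lin_ext f v + lin_ext g v"
  by (simp add: lin_ext_def chain_scale_simps sum.distrib)

lemma lin_ext_minus_fun: "lin_ext (\<lambda>s. f s - g s) v = lin_ext f v - lin_ext g v"
  using lin_ext_plus_fun[of "\<lambda>s. f s - g s" g v] by (simp add: algebra_simps)

lemma lin_ext_ident: "lin_ext (\<lambda>s. Poly_Mapping.single s 1) v = v"
proof (rule poly_mapping_eqI)
  fix t
  have "Poly_Mapping.lookup (lin_ext (\<lambda>s. Poly_Mapping.single s 1) v) t =
      (\<Sum>s\<in>Poly_Mapping.keys v. if s = t then Poly_Mapping.lookup v s else 0)"
    unfolding lin_ext_def lookup_sum
    by (intro sum.cong refl) (simp add: lookup_single when_def)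
  then show "Poly_Mapping.lookup (lin_ext (\<lambda>s. Poly_Mapping.single s 1) v) t =
      Poly_Mapping.lookup v t"
    by (simp add: in_keys_iff)
qed

lemma keys_lin_ext: "Poly_Mapping.keys (lin_ext g v) \<subseteq> (\<Union>s\<in>Poly_Mapping.keys v. Poly_Mapping.keys (g s))"
proof
  fix t assume "t \<in> Poly_Mapping.keys (lin_ext g v)"
  then have "(\<Sum>s\<in>Poly_Mapping.keys v. Poly_Mapping.lookup v s * Poly_Mapping.lookup (g s) t) \<noteq> 0"
    by (simp add: in_keys_iff lin_ext_def lookup_sum)
  then obtain s where "s \<in> Poly_Mapping.keys v" "Poly_Mapping.lookup (g s) t \<noteq> 0"
    by (metis (mono_tags, lifting) mult_zero_right sum.neutral)
  then show "t \<in> (\<Union>s\<in>Poly_Mapping.keys v. Poly_Mapping.keys (g s))"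
    by (auto simp: in_keys_iff)
qed

lemma lin_ext_allowed_chains:
  assumes "\<And>s. s \<in> allowed_paths G p \<Longrightarrow> Poly_Mapping.keys (g s) \<subseteq> allowed_paths G' q"
    and "v \<in> allowed_chains G p"
  shows "lin_ext g v \<in> allowed_chains G' q"
  using assms keys_lin_ext[of g v] unfolding allowed_chains_def by fast


section \<open>The regular boundary as a quotient of the simplicial one\<close>

text \<open>
  The simplicial boundary below is augmented: it sends a one-vertex path to the empty list, and the
  recursion \<open>\<partial>(x s) = s - x \<partial>s\<close> needs no exception for short lists. The projection
  \<open>lin_ext regular_path\<close> removes the augmentation together with the non-regular lists.
\<close>

definition cone :: "'v \<Rightarrow> ('v, 'k::field) chain \<Rightarrow> ('v, 'k) chain" where
  "cone x = lin_ext (\<lambda>s. Poly_Mapping.single (x # s) 1)"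

fun simplicial_boundary :: "'v list \<Rightarrow> ('v, 'k::field) chain" where
  "simplicial_boundary [] = 0"
| "simplicial_boundary (x # s) = Poly_Mapping.single s 1 - cone x (simplicial_boundary s)"

definition regular_path :: "'v list \<Rightarrow> ('v, 'k::field) chain" where
  "regular_path s = (if s \<noteq> [] \<and> distinct_adj s then Poly_Mapping.single s 1 else 0)"

text \<open>
  The face \<open>0\<close> of \<open>x s\<close> is \<open>s\<close>, and its face \<open>q + 1\<close> is the face \<open>q\<close> of \<open>s\<close> with \<open>x\<close> put back in
  front; the shift of the index accounts for the sign in the recursion.
\<close>

lemma simplicial_boundary_eq_sum:
  "(simplicial_boundary s :: ('v, 'k::field) chain) =
    (\<Sum>q<length s. Poly_Mapping.single (omit_nth q s) ((-1) ^ q))"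
proof (induction s)
  case (Cons x s)
  have "cone x (\<Sum>q<length s. Poly_Mapping.single (omit_nth q s) ((-1) ^ q) :: ('v, 'k) chain) =
      (\<Sum>q<length s. chain_scale ((-1) ^ q) (Poly_Mapping.single (x # omit_nth q s) 1))"
    by (simp add: cone_def lin_ext_sum)
  also have "\<dots> = - (\<Sum>q<length s. Poly_Mapping.single (omit_nth (Suc q) (x # s)) ((-1) ^ Suc q))"
    unfolding sum_negf[symmetric]
    by (intro sum.cong refl poly_mapping_eqI) (simp add: omit_nth_def lookup_single when_def)
  finally show ?case
    using Cons.IH
    by (simp add: sum.lessThan_Suc_shift omit_nth_def del: power_Suc sum.lessThan_Suc)
qed simp

text \<open>
  In length one the only face is the empty list, and the projection kills it; this is the truncation
  in the definition of \<^const>\<open>path_boundary\<close>.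
\<close>

lemma path_boundary_eq: "path_boundary s = lin_ext regular_path (simplicial_boundary s)"
proof (cases "length s \<le> 1")
  case True
  then consider "s = []" | x where "s = [x]" by (cases s) auto
  then show ?thesis
    by cases (simp_all add: path_boundary_def regular_path_def cone_def chain_scale_simps)
next
  case False
  have "omit_nth q s \<noteq> []" for q
    using False by (auto simp: omit_nth_def)
  then have "chain_scale c (regular_path (omit_nth q s) :: ('a, 'b) chain) =
      (if distinct_adj (omit_nth q s) then Poly_Mapping.single (omit_nth q s) c else 0)" for q c
    by (auto simp: regular_path_def chain_scale_simps lookup_single when_def intro!: poly_mapping_eqI)
  then show ?thesis
    using False by (simp add: path_boundary_def simplicial_boundary_eq_sum lin_ext_sum)
qed

lemma keys_cone: "Poly_Mapping.keys (cone x v) \<subseteq> (#) x ` Poly_Mapping.keys v"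
  using keys_lin_ext[of "\<lambda>s. Poly_Mapping.single (x # s) 1" v] by (auto simp: cone_def)

text \<open>
  The non-regular lists span a subcomplex: in \<open>\<partial>(x x u)\<close> the two faces \<open>x u\<close> that omit one of the
  repeated vertices cancel, and what remains is \<open>x x \<partial>u\<close>.
\<close>

lemma nonregular_simplicial_boundary:
  assumes "\<not> distinct_adj s"
    and "t \<in> Poly_Mapping.keys (simplicial_boundary s :: ('a, 'b::field) chain)"
  shows "\<not> distinct_adj t"
  using assms
proof (induction s arbitrary: t)
  case (Cons x s)
  show ?case
  proof (cases "distinct_adj s")
    case False
    then show ?thesis
      using Cons.prems Cons.IH[OF False] keys_cone[of x "simplicial_boundary s :: ('a, 'b) chain"]
        keys_diff[of "Poly_Mapping.single s 1" "cone x (simplicial_boundary s) :: ('a, 'b) chain"]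
      by (fastforce simp: distinct_adj_Cons split: if_splits)
  next
    case True
    with Cons.prems(1) obtain u where s: "s = x # u"
      by (cases s) (auto simp: distinct_adj_Cons)
    have eq: "simplicial_boundary (x # s) =
        (cone x (cone x (simplicial_boundary u)) :: ('a, 'b) chain)"
      unfolding s by (simp add: cone_def lin_ext_diff chain_scale_simps)
    then have "t \<in> (#) x ` (#) x ` Poly_Mapping.keys (simplicial_boundary u :: ('a, 'b) chain)"
      using Cons.prems(2) keys_cone[of x "cone x (simplicial_boundary u) :: ('a, 'b) chain"]
        keys_cone[of x "simplicial_boundary u :: ('a, 'b) chain"] unfolding eq by blast
    then show ?thesis by auto
  qed
qed simp

lemma regular_part_eq_0:
  "(\<And>s. s \<in> Poly_Mapping.keys v \<Longrightarrow> \<not> distinct_adj s) \<Longrightarrow> lin_ext regular_path v = 0"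
  by (simp add: lin_ext_def regular_path_def chain_scale_simps)

text \<open>
  So the regular boundary is the map that the simplicial boundary induces on regular chains, which is
  the device that transports identities from one to the other.
\<close>

lemma boundary_regular_part:
  fixes v :: "('v, 'k::field) chain"
  shows "boundary (lin_ext regular_path v) = lin_ext regular_path (lin_ext simplicial_boundary v)"
proof -
  have "boundary (regular_path s :: ('v, 'k) chain) = lin_ext regular_path (simplicial_boundary s)"
    for s
  proof (cases "distinct_adj s")
    case True
    then show ?thesis
      by (cases s) (simp_all add: boundary_eq_lin_ext path_boundary_eq regular_path_def chain_scale_simps)
  next
    case False
    then have "lin_ext regular_path (simplicial_boundary s) = (0 :: ('v, 'k) chain)"
      by (intro regular_part_eq_0) (rule nonregular_simplicial_boundary)
    with False show ?thesis by (simp add: regular_path_def)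
  qed
  then show ?thesis by (simp add: boundary_eq_lin_ext lin_ext_comp)
qed

text \<open>
  A map descends along the projection as soon as it vanishes on what the projection kills.
\<close>

lemma lin_ext_regular_part:
  assumes "g [] = 0" "\<And>s. \<not> distinct_adj s \<Longrightarrow> g s = 0"
  shows "lin_ext g (lin_ext regular_path v) = lin_ext g v"
  unfolding lin_ext_comp using assms
  by (intro lin_ext_cong) (auto simp: regular_path_def chain_scale_simps)


section \<open>The chain map induced by a map of vertices\<close>

definition path_map :: "('v \<Rightarrow> 'w) \<Rightarrow> ('v, 'k::field) chain \<Rightarrow> ('w, 'k) chain" where
  "path_map f = lin_ext (\<lambda>s. regular_path (map f s))"

lemma simplicial_boundary_map:
  "simplicial_boundary (map f s) = lin_ext (\<lambda>t. Poly_Mapping.single (map f t) 1) (simplicial_boundary s)"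
  by (induction s) (simp_all add: cone_def lin_ext_diff lin_ext_comp chain_scale_simps)

lemma path_map_zero [simp]: "path_map f 0 = 0"
  by (simp add: path_map_def)

text \<open>
  Relabelling vertices commutes with the simplicial boundary, and it keeps a non-regular list
  non-regular, so it descends.
\<close>

lemma boundary_path_map:
  fixes v :: "('v, 'k::field) chain" and f :: "'v \<Rightarrow> 'w"
  shows "boundary (path_map f v) = path_map f (boundary v)"
proof -
  have "boundary (regular_path (map f s)) = path_map f (path_boundary s :: ('v, 'k) chain)" for s
  proof -
    have "boundary (regular_path (map f s) :: ('w, 'k) chain) =
        lin_ext regular_path (simplicial_boundary (map f s))"
      using boundary_regular_part[of "Poly_Mapping.single (map f s) 1"]
      by (simp add: chain_scale_simps)
    also have "\<dots> = lin_ext (\<lambda>t. regular_path (map f t)) (simplicial_boundary s)"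
      by (simp add: simplicial_boundary_map lin_ext_comp chain_scale_simps)
    also have "\<dots> = path_map f (path_boundary s)"
      unfolding path_map_def path_boundary_eq
      by (rule lin_ext_regular_part[symmetric]) (auto simp: regular_path_def dest: distinct_adj_mapD)
    finally show ?thesis .
  qed
  then show ?thesis by (simp add: path_map_def boundary_eq_lin_ext lin_ext_comp)
qed

text \<open>
  A path along which some edge is collapsed by \<open>f\<close> has a non-regular image, which counts as zero; the
  image of any other path is again a path of edges.
\<close>

lemma path_map_allowed_chains:
  assumes f: "\<And>x. x \<in> pverts G \<Longrightarrow> f x \<in> pverts G'"
    "\<And>x y. (x, y) \<in> parcs G \<Longrightarrow> f x = f y \<or> (f x, f y) \<in> parcs G'"
    and v: "v \<in> allowed_chains G p"
  shows "path_map f v \<in> allowed_chains G' p"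
  unfolding path_map_def using _ v
proof (rule lin_ext_allowed_chains)
  fix s assume s: "s \<in> allowed_paths G p"
  have "map f s \<in> allowed_paths G' p" if "distinct_adj (map f s)"
  proof -
    have "successively (\<lambda>x y. (x, y) \<in> parcs G \<and> f x \<noteq> f y) s"
      using s that by (auto simp: allowed_paths_def distinct_adj_def successively_map successively_conv_nth)
    then have "successively (\<lambda>x y. (f x, f y) \<in> parcs G') s"
      by (rule successively_mono) (use f(2) in blast)
    then show ?thesis
      using s f(1) by (auto simp: allowed_paths_def successively_map)
  qed
  then show "Poly_Mapping.keys (regular_path (map f s)) \<subseteq> allowed_paths G' p"
    by (simp add: regular_path_def)
qed

lemma path_map_Omega:
  assumes f: "\<And>x. x \<in> pverts G \<Longrightarrow> f x \<in> pverts G'"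
    "\<And>x y. (x, y) \<in> parcs G \<Longrightarrow> f x = f y \<or> (f x, f y) \<in> parcs G'"
    and v: "v \<in> Omega G p"
  shows "path_map f v \<in> Omega G' p"
proof -
  have "path_map f u \<in> allowed_chains G' q" if "u \<in> allowed_chains G q" for u q
    using f that by (rule path_map_allowed_chains)
  with v show ?thesis
    by (cases p) (auto simp: Omega_def boundary_path_map path_map_zero)
qed

lemma regular_part_fixed:
  assumes "\<And>s. s \<in> Poly_Mapping.keys v \<Longrightarrow> s \<noteq> [] \<and> distinct_adj s"
  shows "lin_ext regular_path v = v"
proof -
  have "lin_ext regular_path v = lin_ext (\<lambda>s. Poly_Mapping.single s 1) v"
    using assms by (intro lin_ext_cong) (simp add: regular_path_def)
  then show ?thesis by (simp add: lin_ext_ident)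
qed


section \<open>The homotopy that folds a source onto a neighbour\<close>

text \<open>
  The remaining vertices \<open>t\<close> are relabelled as well, although \<open>a\<close> does not occur in \<open>t\<close> for the paths
  of interest. This makes the operator descend to regular chains: the non-regular list \<open>a a u\<close> must not
  be sent to \<open>a b a u\<close>, which can be regular, but to \<open>a b b \<dots>\<close>.
\<close>

definition prism_path :: "'v \<Rightarrow> 'v \<Rightarrow> 'v list \<Rightarrow> ('v, 'k::field) chain" where
  "prism_path a b s = (case s of [] \<Rightarrow> 0
     | x # t \<Rightarrow> if x = a then Poly_Mapping.single (a # b # map (id(a := b)) t) 1 else 0)"

definition prism :: "'v \<Rightarrow> 'v \<Rightarrow> ('v, 'k::field) chain \<Rightarrow> ('v, 'k) chain" where
  "prism a b = lin_ext (\<lambda>s. lin_ext regular_path (prism_path a b s))"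

lemma map_fold_fresh: "a \<notin> set t \<Longrightarrow> map (id(a := b)) t = t"
  by (simp add: map_idI)

lemma prism_path_eq_0: "a \<notin> set s \<Longrightarrow> prism_path a b s = 0"
  by (cases s) (auto simp: prism_path_def)

lemma simplicial_boundary_vertices:
  "t \<in> Poly_Mapping.keys (simplicial_boundary s :: ('a, 'b::field) chain) \<Longrightarrow> set t \<subseteq> set s"
proof (induction s arbitrary: t)
  case (Cons x s)
  then show ?case
    using keys_cone[of x "simplicial_boundary s :: ('a, 'b) chain"]
      keys_diff[of "Poly_Mapping.single s 1" "cone x (simplicial_boundary s) :: ('a, 'b) chain"]
    by (fastforce split: if_splits)
qed simp

text \<open>
  With \<open>D\<close> the simplicial boundary and \<open>P\<close> the prism, a path \<open>a t\<close> satisfies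
  \<open>D P (a t) = b t - a t + a b D t\<close> and \<open>P D (a t) = P t - P (a D t) = - a b D t\<close>. On paths avoiding
  \<open>a\<close> both sides vanish.
\<close>

lemma prism_path_homotopy:
  assumes "a \<notin> set (tl s)" "s \<noteq> []"
  shows "lin_ext simplicial_boundary (prism_path a b s) + lin_ext (prism_path a b) (simplicial_boundary s)
    = Poly_Mapping.single (map (id(a := b)) s) 1 - (Poly_Mapping.single s 1 :: ('v, 'k::field) chain)"
proof -
  obtain x t where s: "s = x # t" using assms(2) by (cases s) auto
  have t: "a \<notin> set t" using assms(1) s by simp
  have D: "lin_ext (prism_path a b) (simplicial_boundary s) =
    - lin_ext (prism_path a b) (cone x (simplicial_boundary t) :: ('v, 'k) chain)"
    using t by (simp add: s lin_ext_diff prism_path_eq_0 chain_scale_simps)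
  show ?thesis
  proof (cases "x = a")
    case True
    have "lin_ext (prism_path a b) (cone x (simplicial_boundary t)) =
        lin_ext (\<lambda>u. Poly_Mapping.single (a # b # u) 1) (simplicial_boundary t :: ('v, 'k) chain)"
      unfolding cone_def lin_ext_comp
    proof (rule lin_ext_cong)
      fix u assume "u \<in> Poly_Mapping.keys (simplicial_boundary t :: ('v, 'k) chain)"
      then have "a \<notin> set u" using simplicial_boundary_vertices t by fast
      then show "lin_ext (prism_path a b) (Poly_Mapping.single (x # u) 1) =
          (Poly_Mapping.single (a # b # u) 1 :: ('v, 'k) chain)"
        using True map_fold_fresh[of a u b] by (simp add: prism_path_def chain_scale_simps)
    qed
    also have "\<dots> = cone a (cone b (simplicial_boundary t))"
      by (simp add: cone_def lin_ext_comp chain_scale_simps)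
    finally show ?thesis
      using map_fold_fresh[OF t, of b] unfolding D
      by (simp add: s True prism_path_def chain_scale_simps cone_def lin_ext_diff)
  next
    case False
    have "lin_ext (prism_path a b) (cone x (simplicial_boundary t)) = (0 :: ('v, 'k) chain)"
      using False by (simp add: cone_def lin_ext_comp chain_scale_simps prism_path_def)
        (simp add: lin_ext_def chain_scale_simps)
    then show ?thesis
      using map_fold_fresh[OF t, of b] False unfolding D
      by (simp add: s prism_path_def)
  qed
qed

text \<open>
  The identity for the simplicial boundary, pushed through the projection to regular chains.
\<close>

lemma prism_homotopy:
  fixes v :: "('v, 'k::field) chain"
  assumes v: "\<And>s. s \<in> Poly_Mapping.keys v \<Longrightarrow> s \<noteq> [] \<and> distinct_adj s \<and> a \<notin> set (tl s)"
  shows "boundary (prism a b v) + prism a b (boundary v) = path_map (id(a := b)) v - v"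
proof -
  let ?R = "lin_ext regular_path :: ('v, 'k) chain \<Rightarrow> ('v, 'k) chain"
  let ?P = "lin_ext (prism_path a b) :: ('v, 'k) chain \<Rightarrow> ('v, 'k) chain"
  have R_prism: "prism a b (?R u) = ?R (?P u)" for u
    unfolding prism_def lin_ext_comp[of regular_path "prism_path a b"]
  proof (rule lin_ext_regular_part)
    fix s :: "'v list" assume s: "\<not> distinct_adj s"
    show "?R (prism_path a b s) = 0"
    proof (rule regular_part_eq_0)
      fix w assume "w \<in> Poly_Mapping.keys (prism_path a b s :: ('v, 'k) chain)"
      then obtain t where t: "s = a # t" "w = a # map (id(a := b)) s"
        by (auto simp: prism_path_def split: list.splits if_splits)
      then show "\<not> distinct_adj w"
        using s distinct_adj_mapD[of "id(a := b)" s] by (auto simp: distinct_adj_Cons)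
    qed
  qed (simp add: prism_path_def)
  have bd: "boundary u = ?R (lin_ext simplicial_boundary u)" for u :: "('v, 'k) chain"
    by (simp add: boundary_eq_lin_ext lin_ext_comp path_boundary_eq[abs_def])
  have "boundary (prism a b v) + prism a b (boundary v) =
      ?R (lin_ext simplicial_boundary (?P v) + ?P (lin_ext simplicial_boundary v))"
    unfolding bd R_prism lin_ext_add
    by (simp add: prism_def lin_ext_comp[symmetric] boundary_regular_part bd[symmetric])
  also have "lin_ext simplicial_boundary (?P v) + ?P (lin_ext simplicial_boundary v) =
      lin_ext (\<lambda>s. Poly_Mapping.single (map (id(a := b)) s) 1 - Poly_Mapping.single s 1) v"
    unfolding lin_ext_comp lin_ext_plus_fun[symmetric]
    using v by (intro lin_ext_cong prism_path_homotopy) auto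
  also have "?R \<dots> = path_map (id(a := b)) v - ?R v"
    by (simp add: lin_ext_minus_fun lin_ext_diff lin_ext_comp lin_ext_ident path_map_def chain_scale_simps)
  also have "?R v = v" using v by (intro regular_part_fixed) auto
  finally show ?thesis .
qed


section \<open>Dimensions of quotients\<close>

lemma linear_map_inverse:
  assumes T: "linear_map K V W T" and bij: "bij_betw T (carrier V) (carrier W)"
  shows "linear_map K W V (inv_into (carrier V) T)"
proof -
  interpret linear_map K V W T by (rule T)
  let ?S = "inv_into (carrier V) T"
  have S: "?S w \<in> carrier V" "T (?S w) = w" if "w \<in> carrier W" for w
    using that bij by (auto simp: bij_betw_def inv_into_into f_inv_into_f)
  have inj: "x = y" if "T x = T y" "x \<in> carrier V" "y \<in> carrier V" for x y
    using that bij by (auto simp: bij_betw_def inj_on_def)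
  have "?S (w1 \<oplus>\<^bsub>W\<^esub> w2) = ?S w1 \<oplus>\<^bsub>V\<^esub> ?S w2"
    if "w1 \<in> carrier W" "w2 \<in> carrier W" for w1 w2
    using that S by (intro inj) auto
  moreover have "?S (r \<odot>\<^bsub>W\<^esub> w) = r \<odot>\<^bsub>V\<^esub> ?S w" if "r \<in> carrier K" "w \<in> carrier W" for r w
    using that S by (intro inj) auto
  ultimately have "?S \<in> module_hom K W V"
    using S by (auto simp: module_hom_def)
  then show ?thesis
    by unfold_locales
qed

text \<open>
  Rank-nullity settles the case of finite dimension. In infinite dimension \<^const>\<open>vectorspace.dim\<close> is
  the \<open>LEAST\<close> of a property that no number has, which is the same unspecified number on both sides.
\<close>

lemma dim_eq_of_linear_bijection:
  assumes T: "linear_map K V W T" and bij: "bij_betw T (carrier V) (carrier W)"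
  shows "vectorspace.dim K V = vectorspace.dim K W"
proof -
  interpret T: linear_map K V W T by (rule T)
  interpret S: linear_map K W V "inv_into (carrier V) T"
    using T bij by (rule linear_map_inverse)
  have "inv_into (carrier V) T ` carrier W = carrier V"
    using bij_betw_inv_into[OF bij] by (simp add: bij_betw_def)
  then have fin: "T.V.fin_dim \<longleftrightarrow> T.W.fin_dim"
    using T.surj_fin_dim S.surj_fin_dim bij by (auto simp: bij_betw_def)
  show ?thesis
  proof (cases "T.V.fin_dim")
    case True
    then show ?thesis
      using bij T.dim_eq by (auto simp: bij_betw_def)
  next
    case False
    then have "\<not> T.W.fin_dim" using fin by simp
    with False have "(\<exists>A. finite A \<and> card A = n \<and> A \<subseteq> carrier V \<and> module.span K V A = carrier V) \<longleftrightarrow>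
        (\<exists>A. finite A \<and> card A = n \<and> A \<subseteq> carrier W \<and> module.span K W A = carrier W)" for n
      unfolding T.V.fin_dim_def T.W.fin_dim_def by blast
    then show ?thesis
      unfolding T.V.dim_def T.W.dim_def by simp
  qed
qed

definition coset :: "('v, 'k::field) chain set \<Rightarrow> ('v, 'k) chain \<Rightarrow> ('v, 'k) chain set" where
  "coset B z = {z + b |b. b \<in> B}"

lemma carrier_chain_quotient: "carrier (chain_quotient Z B) = coset B ` Z"
  by (simp add: chain_quotient_def coset_def[abs_def])

lemma mem_coset: "x \<in> coset B z \<longleftrightarrow> x - z \<in> B"
  unfolding coset_def by (auto intro: exI[of _ "x - z"])

lemma coset_eq_iff:
  assumes "chain_subspace B"
  shows "coset B x = coset B y \<longleftrightarrow> x - y \<in> B"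
proof
  note BD = chain_subspaceD[OF assms]
  show "x - y \<in> B" if "coset B x = coset B y"
    using that BD(1) by (metis diff_self mem_coset)
  assume xy: "x - y \<in> B"
  show "coset B x = coset B y"
  proof (intro equalityI subsetI)
    show "t \<in> coset B y" if "t \<in> coset B x" for t
      using that BD(2)[OF _ xy, of "t - x"] by (simp add: mem_coset)
    show "t \<in> coset B x" if "t \<in> coset B y" for t
      using that BD(5)[OF _ xy, of "t - y"] by (simp add: mem_coset)
  qed
qed

lemma add_chain_quotient:
  assumes "chain_subspace B"
  shows "coset B x \<oplus>\<^bsub>chain_quotient Z B\<^esub> coset B y = coset B (x + y)"
proof (intro equalityI subsetI)
  note BD = chain_subspaceD[OF assms]
  fix t
  {
    assume "t \<in> coset B x \<oplus>\<^bsub>chain_quotient Z B\<^esub> coset B y"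
    then obtain u v where "t = u + v" "u - x \<in> B" "v - y \<in> B"
      by (auto simp: chain_quotient_def mem_coset)
    with BD(2)[of "u - x" "v - y"] show "t \<in> coset B (x + y)"
      by (simp add: mem_coset algebra_simps)
  next
    assume "t \<in> coset B (x + y)"
    then have "t - y \<in> coset B x" "y \<in> coset B y"
      by (simp_all add: mem_coset BD algebra_simps)
    then show "t \<in> coset B x \<oplus>\<^bsub>chain_quotient Z B\<^esub> coset B y"
      by (simp add: chain_quotient_def) (metis diff_add_cancel)
  }
qed

lemma smult_chain_quotient:
  assumes "chain_subspace B"
  shows "c \<odot>\<^bsub>chain_quotient Z B\<^esub> coset B x = coset B (chain_scale c x)"
proof (intro equalityI subsetI)
  note BD = chain_subspaceD[OF assms]
  fix t
  {
    assume "t \<in> c \<odot>\<^bsub>chain_quotient Z B\<^esub> coset B x"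
    then obtain u b where "t = chain_scale c (x + u) + b" "u \<in> B" "b \<in> B"
      by (auto simp: chain_quotient_def coset_def)
    with BD(2,3) show "t \<in> coset B (chain_scale c x)"
      by (simp add: mem_coset chain_scale_simps algebra_simps)
  next
    assume "t \<in> coset B (chain_scale c x)"
    then obtain b where "t = chain_scale c x + b" "b \<in> B" by (auto simp: coset_def)
    moreover have "x \<in> coset B x" by (simp add: mem_coset BD)
    ultimately show "t \<in> c \<odot>\<^bsub>chain_quotient Z B\<^esub> coset B x" by (auto simp: chain_quotient_def)
  }
qed

text \<open>
  The last two conditions say that the map of quotients induced by the inclusion of \<open>Z'\<close> in \<open>Z\<close> is
  injective and surjective.
\<close>

lemma dim_chain_quotient_inclusion:
  fixes Z B Z' B' :: "('v, 'k::field) chain set"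
  assumes sub: "chain_subspace Z" "chain_subspace B" "chain_subspace Z'" "chain_subspace B'"
    and incl: "Z' \<subseteq> Z" "B' \<subseteq> B"
    and inj: "Z' \<inter> B \<subseteq> B'"
    and surj: "\<And>z. z \<in> Z \<Longrightarrow> \<exists>z'\<in>Z'. z - z' \<in> B"
  shows "vectorspace.dim class_ring (chain_quotient Z' B')
    = vectorspace.dim class_ring (chain_quotient Z B)"
proof (rule dim_eq_of_linear_bijection)
  \<comment> \<open>On a coset of \<open>B'\<close> this is the enclosing coset of \<open>B\<close>, with no choice of representative.\<close>
  define T :: "('v, 'k) chain set \<Rightarrow> ('v, 'k) chain set" where "T X = (\<Union>x\<in>X. coset B x)" for X
  note ZD = chain_subspaceD[OF sub(3)]
  have T: "T (coset B' z) = coset B z" for z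
  proof -
    have "coset B x = coset B z" if "x \<in> coset B' z" for x
      using that incl(2) by (auto simp: coset_eq_iff[OF sub(2)] mem_coset)
    moreover have "z \<in> coset B' z" using chain_subspaceD(1)[OF sub(4)] by (simp add: mem_coset)
    ultimately show ?thesis unfolding T_def by blast
  qed
  interpret V: vectorspace "class_ring :: 'k ring" "chain_quotient Z' B'"
    by (intro vectorspace_chain_quotient sub)
  interpret W: vectorspace "class_ring :: 'k ring" "chain_quotient Z B"
    by (intro vectorspace_chain_quotient sub)
  have "T \<in> module_hom class_ring (chain_quotient Z' B') (chain_quotient Z B)"
    using incl(1)
    by (auto simp: module_hom_def carrier_chain_quotient T add_chain_quotient sub
        smult_chain_quotient)
  then show "linear_map class_ring (chain_quotient Z' B') (chain_quotient Z B) T"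
    by unfold_locales
  have "inj_on T (coset B' ` Z')"
  proof (rule inj_onI, elim imageE)
    fix X Y x y assume *: "T X = T Y" "X = coset B' x" "x \<in> Z'" "Y = coset B' y" "y \<in> Z'"
    then have "x - y \<in> B" by (simp add: T coset_eq_iff sub)
    with * inj ZD(5) have "x - y \<in> B'" by blast
    then show "X = Y" using * by (simp add: coset_eq_iff sub)
  qed
  moreover have "T ` coset B' ` Z' = coset B ` Z"
  proof
    show "T ` coset B' ` Z' \<subseteq> coset B ` Z" using incl(1) by (auto simp: T)
    show "coset B ` Z \<subseteq> T ` coset B' ` Z'"
    proof
      fix X assume "X \<in> coset B ` Z"
      then obtain z where z: "X = coset B z" "z \<in> Z" by blast
      then obtain z' where "z' \<in> Z'" "z - z' \<in> B" using surj by blast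
      then show "X \<in> T ` coset B' ` Z'"
        using z by (auto simp: image_image T coset_eq_iff sub intro!: image_eqI[of _ _ z'])
    qed
  qed
  ultimately show "bij_betw T (carrier (chain_quotient Z' B')) (carrier (chain_quotient Z B))"
    by (simp add: bij_betw_def carrier_chain_quotient)
qed


section \<open>Removing the source\<close>

theorem theorem5p4:
  fixes G G' :: "'v pair_pre_digraph" and a :: 'v and b :: "nat \<Rightarrow> 'v" and n p :: nat
  assumes "pair_digraph G"
    and "a \<in> pverts G"
    and "n \<ge> 1"
    and "inj_on b {..<n}"
    and "{x. (a, x) \<in> parcs G} = b ` {..<n}"
    and "\<forall>x. (x, a) \<notin> parcs G"
    and "\<forall>i. 1 \<le> i \<and> i < n \<longrightarrow> (b 0, b i) \<in> parcs G"
    and "G' = \<lparr> pverts = pverts G - {a}, parcs = parcs G - (\<lambda>i. (a, b i)) ` {..<n} \<rparr>"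
  shows "vectorspace.dim class_ring (path_homology G p :: ('k::field, ('v, 'k) chain set) module)
       = vectorspace.dim class_ring (path_homology G' p :: ('k, ('v, 'k) chain set) module)"
proof -
  interpret pair_digraph G by (rule assms(1))
  let ?f = "id(a := b 0)"
  let ?F = "path_map ?f :: ('v, 'k) chain \<Rightarrow> ('v, 'k) chain"
  let ?H = "prism a (b 0) :: ('v, 'k) chain \<Rightarrow> ('v, 'k) chain"
  have ab0: "(a, b 0) \<in> parcs G" using assms(3,5) by force
  have ab: "y = b 0 \<or> (b 0, y) \<in> parcs G" if "(a, y) \<in> parcs G" for y
  proof -
    have "y \<in> b ` {..<n}" using that assms(5) by blast
    then obtain i where i: "i < n" "y = b i" by blast
    then show ?thesis using assms(7) by (cases "i = 0") auto
  qed
  have b0: "b 0 \<noteq> a" "b 0 \<in> pverts G"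
    using ab0 assms(6) in_arcsD2 by auto
  have verts': "pverts G' = pverts G - {a}" by (simp add: assms(8))
  have arcs': "parcs G' = {(x, y) \<in> parcs G. x \<noteq> a}"
    using assms(5) by (auto simp: assms(8))
  have loopfree: "x \<noteq> y" if "(x, y) \<in> parcs G" for x y
    using pair_no_loops[OF that] by simp

  have allowed: "s \<noteq> [] \<and> distinct_adj s \<and> a \<notin> set (tl s)" if "s \<in> allowed_paths G q" for s q
  proof -
    have succ: "successively (\<lambda>x y. (x, y) \<in> parcs G) s" and ne: "s \<noteq> []"
      using that by (auto simp: allowed_paths_def)
    have "distinct_adj s"
      unfolding distinct_adj_def using succ by (rule successively_mono) (use loopfree in blast)
    moreover have "a \<notin> set (tl s)"
      using succ assms(6) by (induction s rule: induct_list012) auto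
    ultimately show ?thesis using ne by simp
  qed
  \<comment> \<open>\<open>f\<close> is a digraph map from \<open>G\<close> to \<open>G'\<close>, possibly collapsing the edge from \<open>a\<close> to \<open>b\<^sub>0\<close>.\<close>
  have f_verts: "?f x \<in> pverts G'" if "x \<in> pverts G" for x
    using that b0 by (simp add: verts')
  have f_arcs: "?f x = ?f y \<or> (?f x, ?f y) \<in> parcs G'" if "(x, y) \<in> parcs G" for x y
    using that assms(6) ab b0 by (auto simp: arcs')

  have allowed_mono: "allowed_paths G' q \<subseteq> allowed_paths G q" for q
    by (auto simp: allowed_paths_def verts' arcs' elim!: successively_mono)
  then have chains_mono: "allowed_chains G' q \<subseteq> (allowed_chains G q :: ('v, 'k) chain set)" for q
    by (auto simp: allowed_chains_def)
  then have Omega_mono: "Omega G' q \<subseteq> (Omega G q :: ('v, 'k) chain set)" for q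
    by (auto simp: Omega_def split: nat.splits)
  have F_Omega: "?F v \<in> Omega G' q" if "v \<in> Omega G q" for v q
    using f_verts f_arcs that by (rule path_map_Omega)

  have F_fix: "?F v = v" if "v \<in> allowed_chains G' q" for v q
  proof -
    have keys: "s \<noteq> [] \<and> distinct_adj s \<and> a \<notin> set s" if "s \<in> Poly_Mapping.keys v" for s
    proof -
      have "s \<in> allowed_paths G' q"
        using that \<open>v \<in> allowed_chains G' q\<close> by (auto simp: allowed_chains_def)
      moreover from this have "a \<notin> set s" by (auto simp: allowed_paths_def verts')
      ultimately show ?thesis using allowed[of s q] allowed_mono[of q] by auto
    qed
    have "?F v = lin_ext regular_path v"
      unfolding path_map_def by (intro lin_ext_cong) (simp add: map_fold_fresh keys del: fun_upd_apply)
    then show ?thesis using keys by (simp add: regular_part_fixed)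
  qed
  have H_allowed: "?H v \<in> allowed_chains G (Suc q)" if "v \<in> allowed_chains G q" for v q
    unfolding prism_def using _ that
  proof (rule lin_ext_allowed_chains)
    fix s assume s: "s \<in> allowed_paths G q"
    show "Poly_Mapping.keys (lin_ext regular_path (prism_path a (b 0) s) :: ('v, 'k) chain)
        \<subseteq> allowed_paths G (Suc q)"
    \<comment> \<open>If \<open>a b\<^sub>0 t\<close> is regular, the vertex after \<open>b\<^sub>0\<close> is some \<open>b\<^sub>i\<close> with \<open>i \<ge> 1\<close>, so \<open>b\<^sub>0\<close> has an edge to it.\<close>
    proof (cases "hd s = a \<and> distinct_adj (a # b 0 # tl s)")
      case True
      then obtain t where t: "s = a # t" using allowed[OF s] by (cases s) auto
      have "a \<notin> set t" using allowed[OF s] t by simp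
      then have eq: "lin_ext regular_path (prism_path a (b 0) s) =
          (Poly_Mapping.single (a # b 0 # t) 1 :: ('v, 'k) chain)"
        using True map_fold_fresh[of a t "b 0"] unfolding t
        by (simp add: prism_path_def chain_scale_simps regular_path_def)
      have "a # b 0 # t \<in> allowed_paths G (Suc q)"
        using s True ab ab0 b0 unfolding t by (cases t) (auto simp: allowed_paths_def)
      then show ?thesis by (simp add: eq)
    next
      case False
      have "lin_ext regular_path (prism_path a (b 0) s) = (0 :: ('v, 'k) chain)"
      proof (cases s)
        case (Cons x t)
        have "a \<notin> set t" using allowed[OF s] Cons by simp
        then show ?thesis
          using False map_fold_fresh[of a t "b 0"] unfolding Cons
          by (auto simp: prism_path_def chain_scale_simps regular_path_def)
      qed (simp add: prism_path_def)
      then show ?thesis by simp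
    qed
  qed
  have homotopy: "boundary (?H v) + ?H (boundary v) = ?F v - v" if "v \<in> allowed_chains G q" for v q
    by (rule prism_homotopy) (use that allowed in \<open>auto simp: allowed_chains_def\<close>)

  have "vectorspace.dim class_ring (chain_quotient (cycles G' p) (boundaries G' p :: ('v, 'k) chain set))
    = vectorspace.dim class_ring (chain_quotient (cycles G p) (boundaries G p :: ('v, 'k) chain set))"
  proof (rule dim_chain_quotient_inclusion)
    show "cycles G' p \<subseteq> (cycles G p :: ('v, 'k) chain set)"
      using Omega_mono by (auto simp: cycles_def)
    show "boundaries G' p \<subseteq> (boundaries G p :: ('v, 'k) chain set)"
      using Omega_mono by (auto simp: boundaries_def)
    show "cycles G' p \<inter> boundaries G p \<subseteq> (boundaries G' p :: ('v, 'k) chain set)"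
    proof
      fix z :: "('v, 'k) chain" assume "z \<in> cycles G' p \<inter> boundaries G p"
      then obtain w where w: "w \<in> Omega G (Suc p)" "z = boundary w" "z \<in> allowed_chains G' p"
        by (auto simp: cycles_def boundaries_def Omega_def)
      have "z = boundary (?F w)" using w F_fix by (simp add: boundary_path_map)
      with F_Omega[OF w(1)] show "z \<in> boundaries G' p" by (auto simp: boundaries_def)
    qed
    fix z :: "('v, 'k) chain" assume z: "z \<in> cycles G p"
    then have zO: "z \<in> Omega G p" and zA: "z \<in> allowed_chains G p" and z0: "boundary z = 0"
      by (auto simp: cycles_def Omega_def)
    have "?F z \<in> cycles G' p"
      using F_Omega[OF zO] z0 by (simp add: cycles_def boundary_path_map)
    moreover have "z - ?F z \<in> boundaries G p"
    proof -
      have bH: "boundary (?H z) = ?F z - z"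
        using homotopy[OF zA] z0 by (simp add: prism_def)
      have "?F z \<in> allowed_chains G p"
        using F_Omega[OF zO] chains_mono by (auto simp: Omega_def)
      then have "?H z \<in> Omega G (Suc p)"
        using H_allowed[OF zA] zA chain_subspaceD(5)[OF chain_subspace_allowed_chains]
        by (simp add: Omega_def bH)
      then have "?F z - z \<in> boundaries G p"
        unfolding boundaries_def bH[symmetric] by (rule imageI)
      then show ?thesis
        using chain_subspaceD(4)[OF chain_subspace_boundaries] by fastforce
    qed
    ultimately show "\<exists>z'\<in>cycles G' p. z - z' \<in> boundaries G p" by blast
  qed (rule chain_subspace_cycles chain_subspace_boundaries)+
  then show ?thesis by (simp add: path_homology_def)
qed

end
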